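(* Let $G$ be a finite simple block graph that is well-covered, i.e. $\alpha_{\min}(G)=\alpha(G)$. Then for every integer $k\geq \omega(G)$, $G$ admits an equitable $k$-coloring.
   Context: A block graph is a graph in which every block (maximal 2-connected subgraph, or bridge) is a clique. A clique means a maximal complete subgraph; $\omega(G)$ is the size of a largest clique of $G$. $\alpha(G)$ is the size of a largest independent set of $G$, $\alpha(G,v)$ is the largest size of an independent set containing the vertex $v$, and $\alpha_{\min}(G)=\min_{v\in V(G)}\alpha(G,v)$. A graph is well-covered if every vertex lies in a maximum independent set, equivalently $\alpha_{\min}(G)=\alpha(G)$. An equitable $k$-coloring of $G$ is a proper vertex coloring with colors from $\{1,\dots,k\}$ such that every color class has size $\lfloor |V(G)|/k\rfloor$ or $\lceil |V(G)|/k\rceil$ (color classes may be empty when $k>|V(G)|$). *)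

theory Defs
  imports "Graph_Theory.Graph_Theory"
begin

text \<open>
  Finite simple undirected graphs are the library's locale \<open>graph\<close>: finite, loop-free,
  symmetric digraphs without parallel arcs, so that an undirected edge is a pair of opposite
  arcs. The library's \<open>subgraph\<close> is a relation between digraphs; an undirected subgraph
  of \<open>G\<close> is an \<open>H\<close> with \<open>subgraph H G\<close> and \<open>graph H\<close>.
\<close>

definition complete_graph :: "('a,'b) pre_digraph \<Rightarrow> bool" where
  "complete_graph H \<longleftrightarrow> K\<^bsub>card (verts H)\<^esub> H"

definition is_clique :: "('a,'b) pre_digraph \<Rightarrow> ('a,'b) pre_digraph \<Rightarrow> bool" where
  "is_clique G C \<longleftrightarrow> pre_digraph.max_subgraph G complete_graph C"

definition clique_number :: "('a,'b) pre_digraph \<Rightarrow> nat" where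
  "clique_number G = Max {card (verts C) | C. is_clique G C}"

definition two_connected :: "('a,'b) pre_digraph \<Rightarrow> bool" where
  "two_connected H \<longleftrightarrow> graph H \<and> card (verts H) \<ge> 3 \<and> Digraph_Component.connected H \<and>
    (\<forall>v \<in> verts H. Digraph_Component.connected (pre_digraph.del_vert H v))"

text \<open>Deleting an undirected edge means removing both of its arcs.\<close>

definition del_edge :: "('a,'b) pre_digraph \<Rightarrow> 'a \<Rightarrow> 'a \<Rightarrow> ('a,'b) pre_digraph" where
  "del_edge G u v = G\<lparr>arcs := {e \<in> arcs G. {tail G e, head G e} \<noteq> {u, v}}\<rparr>"

definition is_bridge :: "('a,'b) pre_digraph \<Rightarrow> 'a \<Rightarrow> 'a \<Rightarrow> bool" where
  "is_bridge G u v \<longleftrightarrow> u \<rightarrow>\<^bsub>G\<^esub> v \<and> \<not> u \<rightarrow>\<^sup>*\<^bsub>del_edge G u v\<^esub> v"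

text \<open>
  A bridge is regarded as the subgraph consisting of its two ends and the edge between them.
  An isolated vertex does not count as a block; counting it would make no difference below,
  as it always forms a clique.
\<close>

definition is_block :: "('a,'b) pre_digraph \<Rightarrow> ('a,'b) pre_digraph \<Rightarrow> bool" where
  "is_block G B \<longleftrightarrow> pre_digraph.max_subgraph G two_connected B \<or>
    (\<exists>u v. is_bridge G u v \<and> B = G \<restriction> {u, v})"

definition block_graph :: "('a,'b) pre_digraph \<Rightarrow> bool" where
  "block_graph G \<longleftrightarrow> graph G \<and> (\<forall>B. is_block G B \<longrightarrow> is_clique G B)"

definition independent_set :: "('a,'b) pre_digraph \<Rightarrow> 'a set \<Rightarrow> bool" where
  "independent_set G S \<longleftrightarrow> S \<subseteq> verts G \<and> (\<forall>u \<in> S. \<forall>v \<in> S. \<not> u \<rightarrow>\<^bsub>G\<^esub> v)"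

definition alpha :: "('a,'b) pre_digraph \<Rightarrow> nat" where
  "alpha G = Max {card S | S. independent_set G S}"

definition alpha_at :: "('a,'b) pre_digraph \<Rightarrow> 'a \<Rightarrow> nat" where
  "alpha_at G v = Max {card S | S. independent_set G S \<and> v \<in> S}"

definition alpha_min :: "('a,'b) pre_digraph \<Rightarrow> nat" where
  "alpha_min G = Min (alpha_at G ` verts G)"

text \<open>
  For the graph without vertices \<^term>\<open>alpha_min G\<close> is an unspecified number. For all other
  graphs the lemma \<open>well_covered_iff\<close> gives the equivalent condition that every vertex
  lies in a maximum independent set.
\<close>

definition well_covered :: "('a,'b) pre_digraph \<Rightarrow> bool" where
  "well_covered G \<longleftrightarrow> alpha_min G = alpha G"

lemma well_covered_iff:
  assumes "graph G" and ne: "verts G \<noteq> {}"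
  shows "well_covered G \<longleftrightarrow>
    (\<forall>v \<in> verts G. \<exists>S. independent_set G S \<and> card S = alpha G \<and> v \<in> S)"
proof -
  interpret graph G by fact
  let ?I = "{card S | S. independent_set G S}"
  let ?J = "\<lambda>v. {card S | S. independent_set G S \<and> v \<in> S}"
  have finI: "finite ?I"
    by (rule finite_subset[of _ "card ` Pow (verts G)"]) (auto simp: independent_set_def)
  have finJ: "finite (?J v)" for v
    by (rule finite_subset[OF _ finI]) auto
  have neJ: "?J v \<noteq> {}" if "v \<in> verts G" for v
  proof -
    have "independent_set G {v}"
      using that adj_not_same by (auto simp: independent_set_def)
    then show ?thesis by blast
  qed
  have le: "alpha_at G v \<le> alpha G" if "v \<in> verts G" for v
    unfolding alpha_at_def alpha_def using neJ[OF that] finI by (intro Max_mono) auto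
  have eq: "alpha_at G v = alpha G \<longleftrightarrow>
      (\<exists>S. independent_set G S \<and> card S = alpha G \<and> v \<in> S)" if v: "v \<in> verts G" for v
  proof
    assume "alpha_at G v = alpha G"
    moreover have "alpha_at G v \<in> ?J v"
      unfolding alpha_at_def using finJ neJ[OF v] by (rule Max_in)
    ultimately show "\<exists>S. independent_set G S \<and> card S = alpha G \<and> v \<in> S" by auto
  next
    assume "\<exists>S. independent_set G S \<and> card S = alpha G \<and> v \<in> S"
    then have "alpha G \<in> ?J v" by (metis (mono_tags, lifting) mem_Collect_eq)
    then have "alpha G \<le> alpha_at G v"
      unfolding alpha_at_def using finJ by (intro Max_ge)
    with le[OF v] show "alpha_at G v = alpha G" by simp
  qed
  have "alpha_min G = alpha G \<longleftrightarrow> (\<forall>v \<in> verts G. alpha_at G v = alpha G)"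
  proof
    assume *: "alpha_min G = alpha G"
    show "\<forall>v \<in> verts G. alpha_at G v = alpha G"
    proof
      fix v assume v: "v \<in> verts G"
      then have "alpha_min G \<le> alpha_at G v" unfolding alpha_min_def by (intro Min_le) auto
      with * le[OF v] show "alpha_at G v = alpha G" by simp
    qed
  next
    assume "\<forall>v \<in> verts G. alpha_at G v = alpha G"
    with ne have "alpha_at G ` verts G = {alpha G}" by auto
    then show "alpha_min G = alpha G" by (simp add: alpha_min_def)
  qed
  with eq show ?thesis by (simp add: well_covered_def)
qed

definition proper_coloring :: "('a,'b) pre_digraph \<Rightarrow> nat \<Rightarrow> ('a \<Rightarrow> nat) \<Rightarrow> bool" where
  "proper_coloring G k c \<longleftrightarrow> c ` verts G \<subseteq> {1..k} \<and> (\<forall>u v. u \<rightarrow>\<^bsub>G\<^esub> v \<longrightarrow> c u \<noteq> c v)"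

definition equitable_coloring :: "('a,'b) pre_digraph \<Rightarrow> nat \<Rightarrow> ('a \<Rightarrow> nat) \<Rightarrow> bool" where
  "equitable_coloring G k c \<longleftrightarrow> proper_coloring G k c \<and>
    (\<forall>i \<in> {1..k}. int (card {v \<in> verts G. c v = i}) \<in>
      {\<lfloor>real (card (verts G)) / real k\<rfloor>, \<lceil>real (card (verts G)) / real k\<rceil>})"

end

theory Submission
  imports Defs
begin

text \<open>
  A block graph has a partition \<open>P\<close> of its vertices into cliques and an independent set of size
  \<open>card P\<close>, obtained by repeatedly removing the closed neighbourhood of a simplicial vertex. If the
  graph is well-covered, every vertex \<open>y\<close> lies in an independent set meeting all parts, so no vertex
  outside a part is adjacent to all of it: the parts are maximal cliques, and every other block
  meets each part in at most one vertex. Thus the parts are arranged in a tree-like fashion, and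
  there is a block all of whose vertices but at most one lie in parts that have no other
  edges to the outside. Remove these parts, colour the rest equitably by induction, and extend the
  colouring. Among all proper extensions one that minimises the sum of the squares of the
  sizes of the colour classes is equitable, since otherwise one unit could be moved from a
  class to a class that is smaller by at least two.
\<close>

subsection \<open>Balancing an extension of a colouring\<close>

lemma card_color_class_upd:
  fixes c :: "'a \<Rightarrow> 'b"
  assumes "finite V" "x \<in> V" "c x \<noteq> b"
  shows "card {v \<in> V. (c(x := b)) v = i} =
    (if i = c x then card {v \<in> V. c v = i} - 1
     else if i = b then Suc (card {v \<in> V. c v = i}) else card {v \<in> V. c v = i})"
proof -
  consider "i = c x" | "i = b" "i \<noteq> c x" | "i \<noteq> b" "i \<noteq> c x" by blast
  then show ?thesis
  proof cases
    case 1
    then have "{v \<in> V. (c(x := b)) v = i} = {v \<in> V. c v = i} - {x}" using assms by auto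
    then show ?thesis using 1 assms by simp
  next
    case 2
    then have "{v \<in> V. (c(x := b)) v = i} = insert x {v \<in> V. c v = i}" using assms by auto
    then show ?thesis using 2 assms by simp
  next
    case 3
    then have "{v \<in> V. (c(x := b)) v = i} = {v \<in> V. c v = i}" using assms by auto
    then show ?thesis using 3 by simp
  qed
qed

text \<open>The potential behind the balancing: moving a unit from \<open>a\<close> to
  \<open>b\<close> lowers the sum of squares by \<open>2 * (n a - n b - 1)\<close>, which is
  positive once the surplus is at least two.\<close>

lemma sum_power2_transfer_less:
  fixes n m :: "'b \<Rightarrow> nat"
  assumes K: "finite K" "a \<in> K" "b \<in> K" and ab: "n b + 2 \<le> n a"
    and m: "m = n(a := n a - 1, b := Suc (n b))"
  shows "(\<Sum>i\<in>K. (m i)\<^sup>2) < (\<Sum>i\<in>K. (n i)\<^sup>2)"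
proof -
  have ne: "a \<noteq> b" using ab by auto
  have split: "(\<Sum>i\<in>K. g i) = g a + (g b + (\<Sum>i\<in>K - {a} - {b}. g i))" for g :: "'b \<Rightarrow> nat"
    using K ne sum.remove[of K a g] sum.remove[of "K - {a}" b g] by simp
  have rest: "(\<Sum>i\<in>K - {a} - {b}. (m i)\<^sup>2) = (\<Sum>i\<in>K - {a} - {b}. (n i)\<^sup>2)"
    by (rule sum.cong) (auto simp: m)
  obtain d where d: "n a = n b + 2 + d" using ab le_Suc_ex by blast
  have "(m a)\<^sup>2 + (m b)\<^sup>2 < (n a)\<^sup>2 + (n b)\<^sup>2"
    using ne by (simp add: m d power2_eq_square algebra_simps)
  then show ?thesis unfolding split[of "\<lambda>i. (m i)\<^sup>2"] split[of "\<lambda>i. (n i)\<^sup>2"] rest by simp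
qed

text \<open>Composing any injection into \<open>{1..k}\<close> with the transposition of
  \<open>t\<close> and \<open>f x\<close> prescribes the value at \<open>x\<close> without leaving
  the range.\<close>

lemma ex_inj_on_with_value:
  assumes "finite Q" "card Q \<le> k" "x \<in> Q" "t \<in> {1..k}"
  shows "\<exists>g. inj_on g Q \<and> g ` Q \<subseteq> {1..k} \<and> g x = (t::nat)"
proof -
  obtain f where f: "inj_on f Q" "f ` Q \<subseteq> {1..k}"
    using card_le_inj[of Q "{1..k}"] assms by auto
  let ?s = "transpose t (f x)"
  have "inj_on (?s \<circ> f) Q"
    using f(1) by (intro comp_inj_on) (auto intro: inj_on_subset)
  moreover have "(?s \<circ> f) ` Q \<subseteq> {1..k}"
    using f(2) assms(3,4) by (auto simp: transpose_def)
  ultimately show ?thesis by (intro exI[of _ "?s \<circ> f"]) auto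
qed

text \<open>
  \<open>A\<close> is already coloured by \<open>c0\<close>, the cliques in \<open>J\<close> are to be added. They are attached to \<open>A\<close>
  and to each other by a single block \<open>X \<union> W\<close>, which has at most one vertex (the one in \<open>X\<close>) in \<open>A\<close>
  and at most one vertex in each clique of \<open>J\<close>. Hence a colouring is proper as soon as it
  is injective on each clique of \<open>J\<close> and on \<open>X \<union> W\<close>.
\<close>

locale pendant_cliques =
  fixes A :: "'a set" and J :: "'a set set" and X W :: "'a set" and k :: nat and c0 :: "'a \<Rightarrow> nat"
  assumes finite_A: "finite A" and finite_J: "finite J" and finite_Q: "Q \<in> J \<Longrightarrow> finite Q"
    and disjoint_J: "disjoint J" and disjoint_A: "A \<inter> \<Union>J = {}"
    and X_sub: "X \<subseteq> A" and X_single: "p \<in> X \<Longrightarrow> q \<in> X \<Longrightarrow> p = q"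
    and W_sub: "W \<subseteq> \<Union>J"
    and W_single: "Q \<in> J \<Longrightarrow> x \<in> Q \<Longrightarrow> y \<in> Q \<Longrightarrow> x \<in> W \<Longrightarrow> y \<in> W \<Longrightarrow> x = y"
    and W_large: "Q \<in> J \<Longrightarrow> x \<in> Q \<Longrightarrow> x \<in> W \<Longrightarrow> 2 \<le> card Q"
    and c0_range: "c0 ` A \<subseteq> {1..k}"
    and c0_balanced: "i \<in> {1..k} \<Longrightarrow> j \<in> {1..k} \<Longrightarrow>
      card {v \<in> A. c0 v = i} \<le> card {v \<in> A. c0 v = j} + 1"
    and card_Q: "Q \<in> J \<Longrightarrow> card Q \<le> k"
    and card_XW: "card (X \<union> W) \<le> k"
begin

abbreviation "V \<equiv> A \<union> \<Union>J"

definition cnt :: "('a \<Rightarrow> nat) \<Rightarrow> nat \<Rightarrow> nat" where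
  "cnt c i = card {v \<in> V. c v = i}"

definition valid :: "('a \<Rightarrow> nat) \<Rightarrow> bool" where
  "valid c \<longleftrightarrow> (\<forall>v\<in>A. c v = c0 v) \<and> c ` \<Union>J \<subseteq> {1..k} \<and> (\<forall>Q\<in>J. inj_on c Q) \<and> inj_on c (X \<union> W)"

lemma finite_V: "finite V"
  using finite_A finite_J finite_Q by auto

lemma eq_of_mem: "Q \<in> J \<Longrightarrow> Q' \<in> J \<Longrightarrow> x \<in> Q \<Longrightarrow> x \<in> Q' \<Longrightarrow> Q = Q'"
  using disjoint_J by (auto simp: disjoint_def)

lemma finite_XW: "finite (X \<union> W)"
  using finite_V X_sub W_sub by (meson Un_mono finite_subset)

text \<open>The block \<open>X \<union> W\<close> is coloured first, agreeing with \<open>c0\<close>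
  on the at most one vertex of \<open>X\<close>. Each clique of \<open>J\<close> then has at most
  one prescribed value, at its vertex in \<open>W\<close>, so the cliques can be coloured
  independently.\<close>

lemma ex_valid: "\<exists>c. valid c"
proof -
  have cX: "c0 ` X \<subseteq> {1..k}" using c0_range X_sub by blast
  have "\<exists>f. inj_on f (X \<union> W) \<and> f ` (X \<union> W) \<subseteq> {1..k} \<and> (\<forall>p\<in>X. f p = c0 p)"
  proof (cases "X = {}")
    case True
    then show ?thesis
      using card_le_inj[of "X \<union> W" "{1..k}"] finite_XW card_XW by auto
  next
    case False
    then obtain p where p: "p \<in> X" by blast
    then have X: "X = {p}" using X_single by auto
    from ex_inj_on_with_value[OF finite_XW card_XW, of p "c0 p"] p cX
    show ?thesis unfolding X by auto
  qed
  then obtain f where f: "inj_on f (X \<union> W)" "f ` (X \<union> W) \<subseteq> {1..k}" "\<And>p. p \<in> X \<Longrightarrow> f p = c0 p"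
    by blast
  have "\<forall>Q\<in>J. \<exists>g. inj_on g Q \<and> g ` Q \<subseteq> {1..k} \<and> (\<forall>x\<in>Q \<inter> W. g x = f x)"
  proof
    fix Q assume Q: "Q \<in> J"
    show "\<exists>g. inj_on g Q \<and> g ` Q \<subseteq> {1..k} \<and> (\<forall>x\<in>Q \<inter> W. g x = f x)"
    proof (cases "Q \<inter> W = {}")
      case True
      then show ?thesis
        using card_le_inj[of Q "{1..k}"] finite_Q[OF Q] card_Q[OF Q] by auto
    next
      case False
      then obtain x where x: "x \<in> Q" "x \<in> W" by blast
      then have QW: "Q \<inter> W = {x}" using W_single[OF Q] by blast
      have "f x \<in> {1..k}" using f(2) x by blast
      from ex_inj_on_with_value[OF finite_Q[OF Q] card_Q[OF Q] x(1) this]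
      show ?thesis unfolding QW by auto
    qed
  qed
  then obtain g where g: "\<And>Q. Q \<in> J \<Longrightarrow> inj_on (g Q) Q" "\<And>Q. Q \<in> J \<Longrightarrow> g Q ` Q \<subseteq> {1..k}"
      "\<And>Q x. Q \<in> J \<Longrightarrow> x \<in> Q \<Longrightarrow> x \<in> W \<Longrightarrow> g Q x = f x"
    by (metis IntI)
  \<comment> \<open>Disjointness of \<open>J\<close> makes the \<open>THE\<close> well defined on
    the added cliques; outside \<open>V\<close> the value does not matter.\<close>
  define c where "c v = (if v \<in> A then c0 v else g (THE Q. Q \<in> J \<and> v \<in> Q) v)" for v
  have cQ: "c v = g Q v" if "Q \<in> J" "v \<in> Q" for Q v
  proof -
    have "(THE Q. Q \<in> J \<and> v \<in> Q) = Q" using that eq_of_mem by (intro the_equality) auto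
    moreover have "v \<notin> A" using that disjoint_A by blast
    ultimately show ?thesis by (simp add: c_def)
  qed
  have "c v = f v" if "v \<in> X \<union> W" for v
  proof (cases "v \<in> X")
    case True
    then show ?thesis using X_sub f(3) by (auto simp: c_def)
  next
    case False
    then obtain Q where "Q \<in> J" "v \<in> Q" "v \<in> W" using \<open>v \<in> X \<union> W\<close> W_sub by blast
    then show ?thesis using cQ g(3) by simp
  qed
  then have "inj_on c (X \<union> W)" using f(1) inj_on_cong[of "X \<union> W" c f] by blast
  moreover have "inj_on c Q" if "Q \<in> J" for Q
    using g(1)[OF that] cQ[OF that] inj_on_cong[of Q c "g Q"] by blast
  moreover have "c ` \<Union>J \<subseteq> {1..k}" using g(2) cQ by (auto simp: image_subset_iff)
  ultimately show ?thesis unfolding valid_def by (intro exI[of _ c]) (auto simp: c_def)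
qed

lemma cnt_upd:
  assumes "x \<in> \<Union>J" "c x \<noteq> b"
  shows "cnt (c(x := b)) = (cnt c)(c x := cnt c (c x) - 1, b := Suc (cnt c b))"
proof
  fix i
  have "x \<in> V" using assms by blast
  from card_color_class_upd[where c = c and b = b and i = i, OF finite_V this assms(2)]
  show "cnt (c(x := b)) i = ((cnt c)(c x := cnt c (c x) - 1, b := Suc (cnt c b))) i"
    using assms(2) unfolding cnt_def by simp
qed

text \<open>Ensures that subtracting one from the class of \<open>x\<close> is not truncated at 0,
  so that giving the unit back restores the count.\<close>

lemma cnt_pos: "x \<in> \<Union>J \<Longrightarrow> 0 < cnt c (c x)"
proof -
  assume "x \<in> \<Union>J"
  then have "x \<in> {v \<in> V. c v = c x}" by blast
  moreover have "finite {v \<in> V. c v = c x}" by (rule finite_subset[OF _ finite_V]) blast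
  ultimately show ?thesis unfolding cnt_def card_gt_0_iff by blast
qed

text \<open>Injectivity on each clique of \<open>J\<close> lets a clique contribute one vertex or
  none to a colour class, so vertices can be counted by cliques.\<close>

lemma cnt_split:
  assumes "valid c"
  shows "cnt c i = card {v \<in> A. c0 v = i} + card {Q \<in> J. i \<in> c ` Q}"
proof -
  have V: "{v \<in> V. c v = i} = {v \<in> A. c0 v = i} \<union> (\<Union>Q\<in>J. {v \<in> Q. c v = i})"
    using assms by (auto simp: valid_def)
  have one: "card {v \<in> Q. c v = i} = (if i \<in> c ` Q then 1 else 0)" if Q: "Q \<in> J" for Q
  proof (cases "i \<in> c ` Q")
    case True
    then obtain x where "x \<in> Q" "c x = i" by blast
    then have "{v \<in> Q. c v = i} = {x}"
      using assms Q by (auto simp: valid_def inj_on_def)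
    then show ?thesis using True by simp
  next
    case False
    then have "{v \<in> Q. c v = i} = {}" by blast
    then show ?thesis using False by (simp only: card.empty) simp
  qed
  have "card (\<Union>Q\<in>J. {v \<in> Q. c v = i}) = (\<Sum>Q\<in>J. card {v \<in> Q. c v = i})"
    using finite_J finite_Q eq_of_mem by (intro card_UN_disjoint) auto
  also have "\<dots> = card {Q \<in> J. i \<in> c ` Q}"
    using one finite_J by (simp add: sum.If_cases Int_def)
  finally have "card (\<Union>Q\<in>J. {v \<in> Q. c v = i}) = card {Q \<in> J. i \<in> c ` Q}" .
  moreover have "card {v \<in> V. c v = i} = card {v \<in> A. c0 v = i} + card (\<Union>Q\<in>J. {v \<in> Q. c v = i})"
    unfolding V using finite_A finite_J finite_Q disjoint_A by (intro card_Un_disjoint) auto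
  ultimately show ?thesis by (simp add: cnt_def)
qed

text \<open>Since \<open>x\<close> lies outside \<open>A\<close> and in no other clique of
  \<open>J\<close>, only injectivity on \<open>Q\<close> and, for \<open>x\<close> in
  \<open>W\<close>, on \<open>X \<union> W\<close> is at stake.\<close>

lemma valid_upd:
  assumes c: "valid c" and Q: "Q \<in> J" "x \<in> Q" and b: "b \<in> {1..k}" "b \<notin> c ` Q"
    and W: "x \<in> W \<Longrightarrow> b \<notin> c ` (X \<union> W)"
  shows "valid (c(x := b))"
  unfolding valid_def
proof (intro conjI ballI)
  have xA: "x \<notin> A" using Q disjoint_A by blast
  show "(c(x := b)) v = c0 v" if "v \<in> A" for v using c xA that by (auto simp: valid_def)
  show "c(x := b) ` \<Union>J \<subseteq> {1..k}" using c b by (auto simp: valid_def image_subset_iff)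
  show "inj_on (c(x := b)) R" if R: "R \<in> J" for R
  proof (cases "R = Q")
    case True
    then show ?thesis using c b Q by (auto simp: valid_def intro: inj_on_fun_updI)
  next
    case False
    then have "x \<notin> R" using eq_of_mem Q R by blast
    then have "inj_on (c(x := b)) R = inj_on c R" by (intro inj_on_cong) auto
    then show ?thesis using c R by (auto simp: valid_def)
  qed
  show "inj_on (c(x := b)) (X \<union> W)"
  proof (cases "x \<in> W")
    case True
    then show ?thesis using c W by (intro inj_on_fun_updI) (auto simp: valid_def)
  next
    case False
    then have "x \<notin> X \<union> W" using X_sub xA by blast
    then have "inj_on (c(x := b)) (X \<union> W) = inj_on c (X \<union> W)" by (intro inj_on_cong) auto
    then show ?thesis using c by (auto simp: valid_def)
  qed
qed

text \<open>
  If some clique of \<open>J\<close> contains \<open>a\<close> but not \<open>b\<close> and its \<open>a\<close>-coloured vertex is outside \<open>W\<close>, then that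
  vertex can be recoloured. Otherwise, as \<open>W\<close> contains \<open>a\<close> at most once and \<open>A\<close> accounts for at most
  one of the surplus of two, exactly one clique contains \<open>a\<close> but not \<open>b\<close>, and none contains \<open>b\<close> but
  not \<open>a\<close>. Its vertex \<open>x\<close> in \<open>W\<close> has to become \<open>b\<close>; if \<open>b\<close> is taken by another \<open>y\<close> in \<open>W\<close>, then
  exchanging \<open>a\<close> and \<open>b\<close> in the clique of \<open>y\<close> makes room for it.
\<close>

lemma transfer_or_blocked:
  assumes c: "valid c" and a: "a \<in> {1..k}" and b: "b \<in> {1..k}" and ab: "cnt c b + 2 \<le> cnt c a"
  shows "(\<exists>c'. valid c' \<and> cnt c' = (cnt c)(a := cnt c a - 1, b := Suc (cnt c b)))
    \<or> b \<in> c ` X \<and> (\<exists>Q\<in>J. \<exists>x\<in>Q \<inter> W. c x = a \<and> b \<notin> c ` Q)"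
proof -
  have ne: "a \<noteq> b" using ab by auto
  define Ja where "Ja = {Q \<in> J. a \<in> c ` Q \<and> b \<notin> c ` Q}"
  define Jb where "Jb = {Q \<in> J. b \<in> c ` Q \<and> a \<notin> c ` Q}"
  define Jab where "Jab = {Q \<in> J. b \<in> c ` Q \<and> a \<in> c ` Q}"
  have fin: "finite Ja" "finite Jb" "finite Jab" using finite_J by (auto simp: Ja_def Jb_def Jab_def)
  have "{Q \<in> J. a \<in> c ` Q} = Ja \<union> Jab" "{Q \<in> J. b \<in> c ` Q} = Jb \<union> Jab"
    by (auto simp: Ja_def Jb_def Jab_def)
  moreover have "Ja \<inter> Jab = {}" "Jb \<inter> Jab = {}"
    by (auto simp: Ja_def Jb_def Jab_def)
  ultimately have "cnt c a = card {v \<in> A. c0 v = a} + (card Ja + card Jab)"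
      "cnt c b = card {v \<in> A. c0 v = b} + (card Jb + card Jab)"
    using fin by (simp_all add: cnt_split[OF c] card_Un_disjoint)
  \<comment> \<open>The cliques in \<open>Jab\<close> contribute equally to both counts and
    cancel.\<close>
  then have card: "card Jb < card Ja" using c0_balanced[OF a b] ab by linarith
  have move: "\<exists>c'. valid c' \<and> cnt c' = (cnt c)(a := cnt c a - 1, b := Suc (cnt c b))"
    if "Q \<in> J" "x \<in> Q" "c x = a" "b \<notin> c ` Q" "x \<in> W \<Longrightarrow> b \<notin> c ` (X \<union> W)" for Q x
    using valid_upd[OF c that(1,2) b that(4,5)] cnt_upd[of x c b] that ne by blast
  show ?thesis
  proof (cases "\<exists>Q\<in>Ja. \<exists>x\<in>Q. c x = a \<and> x \<notin> W")
    case True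
    then show ?thesis using move unfolding Ja_def by blast
  next
    case False
    then have port: "x \<in> W" if "Q \<in> Ja" "x \<in> Q" "c x = a" for Q x using that by blast
    obtain Q where Q: "Q \<in> Ja" using card by (metis card.empty ex_in_conv not_less_zero)
    then obtain x where x: "x \<in> Q" "c x = a" by (auto simp: Ja_def)
    have xW: "x \<in> W" using port Q x by blast
    have QJ: "Q \<in> J" "b \<notin> c ` Q" using Q by (auto simp: Ja_def)
    have inj: "inj_on c (X \<union> W)" using c by (simp add: valid_def)
    have "Ja \<subseteq> {Q}"
    proof
      fix R assume R: "R \<in> Ja"
      then obtain y where y: "y \<in> R" "c y = a" by (auto simp: Ja_def)
      then have "x = y" using port[OF R] xW x inj by (auto simp: inj_on_def)
      then have "R = Q" using eq_of_mem y x R Q by (auto simp: Ja_def)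
      then show "R \<in> {Q}" by simp
    qed
    then have "card Ja \<le> 1" using card_mono[of "{Q}" Ja] by simp
    then have "card Jb = 0" using card by linarith
    then have Jb: "Jb = {}" using fin by simp
    consider "b \<notin> c ` (X \<union> W)" | "b \<in> c ` X" | y where "y \<in> W" "c y = b" by blast
    then show ?thesis
    proof cases
      case 1
      then show ?thesis using move QJ x by blast
    next
      case 2
      then show ?thesis using QJ x xW by blast
    next
      case 3
      then obtain R where R: "R \<in> J" "y \<in> R" using W_sub by blast
      with 3 Jb have "a \<in> c ` R" by (auto simp: Jb_def)
      then obtain z where z: "z \<in> R" "c z = a" by blast
      have RQ: "R \<noteq> Q" using R 3 QJ by blast
      have disj: "x \<notin> R" "y \<notin> Q" "z \<notin> Q" using RQ R z x QJ eq_of_mem by blast+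
      have dist: "x \<noteq> y" "x \<noteq> z" "y \<noteq> z" using x 3 z ne disj by auto
      define c' where "c' = c(x := b, y := a, z := b)"
      have zW: "z \<notin> W" using dist W_single[OF R(1) z(1) R(2)] 3 by blast
      have XW: "c v \<noteq> a" "c v \<noteq> b" if "v \<in> X \<union> W" "v \<noteq> x" "v \<noteq> y" for v
        using that inj xW 3 x by (auto simp: inj_on_def)
      have Rc: "c v \<noteq> a" "c v \<noteq> b" if "v \<in> R" "v \<noteq> z" "v \<noteq> y" for v
        using that c R z 3 by (auto simp: inj_on_def valid_def)
      have "valid c'"
        unfolding valid_def
      proof (intro conjI ballI)
        show "c' v = c0 v" if "v \<in> A" for v
          using that disjoint_A c QJ x R z by (auto simp: valid_def c'_def)
        show "c' ` \<Union>J \<subseteq> {1..k}" using c a b by (auto simp: valid_def c'_def image_subset_iff)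
        show "inj_on c' (X \<union> W)"
        proof -
          have "z \<notin> X" using X_sub disjoint_A z R by blast
          then show ?thesis
            using inj XW zW dist ne by (auto simp: c'_def inj_on_def)
        qed
        show "inj_on c' S" if S: "S \<in> J" for S
        proof -
          have inS: "inj_on c S" using c S by (auto simp: valid_def)
          consider "S = Q" | "S = R" | "x \<notin> S" "y \<notin> S" "z \<notin> S"
            using eq_of_mem S QJ x R z by blast
          then show ?thesis
          proof cases
            case 1
            then have "inj_on c' S = inj_on (c(x := b)) S"
              using disj by (intro inj_on_cong) (auto simp: c'_def)
            then show ?thesis using inj_on_fun_updI[OF inS] 1 QJ by blast
          next
            case 2
            then show ?thesis using inS Rc dist ne disj by (auto simp: c'_def inj_on_def)
          next
            case 3
            then have "inj_on c' S = inj_on c S" by (intro inj_on_cong) (auto simp: c'_def)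
            then show ?thesis using inS by simp
          qed
        qed
      qed
      \<comment> \<open>The recolourings of \<open>x\<close>, \<open>y\<close> and \<open>z\<close>
        move a unit from \<open>a\<close> to \<open>b\<close>, back, and again to \<open>b\<close>:
        a single transfer in total.\<close>
      moreover have "cnt c' = (cnt c)(a := cnt c a - 1, b := Suc (cnt c b))"
      proof -
        have UJ: "x \<in> \<Union>J" "y \<in> \<Union>J" "z \<in> \<Union>J" using QJ x R z by blast+
        have "cnt (c(x := b)) = (cnt c)(a := cnt c a - 1, b := Suc (cnt c b))"
          using cnt_upd[OF UJ(1), of c b] x ne by simp
        moreover have "cnt (c(x := b, y := a)) = cnt c"
          using cnt_upd[OF UJ(2), of "c(x := b)" a] calculation dist ne 3 cnt_pos[OF UJ(1), of c] x
          by (auto simp: fun_eq_iff)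
        moreover have "cnt c' = (cnt (c(x := b, y := a)))(a := cnt (c(x := b, y := a)) a - 1,
            b := Suc (cnt (c(x := b, y := a)) b))"
          unfolding c'_def using cnt_upd[OF UJ(3), of "c(x := b, y := a)" b] dist ne z by simp
        ultimately show ?thesis by simp
      qed
      ultimately show ?thesis by blast
    qed
  qed
qed

text \<open>
  When \<open>b\<close> is blocked by the vertex of \<open>X\<close>, the transfer is done via the colour \<open>d\<close> of a further vertex of
  the clique: \<open>d\<close> to \<open>b\<close> is possible by recolouring that vertex, and \<open>a\<close> to \<open>d\<close> is not blocked.
\<close>

lemma ex_smaller:
  assumes c: "valid c" and a: "a \<in> {1..k}" and b: "b \<in> {1..k}" and ab: "cnt c b + 2 \<le> cnt c a"
  shows "\<exists>c'. valid c' \<and> (\<Sum>i\<in>{1..k}. (cnt c' i)\<^sup>2) < (\<Sum>i\<in>{1..k}. (cnt c i)\<^sup>2)"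
proof (cases "\<exists>c'. valid c' \<and> cnt c' = (cnt c)(a := cnt c a - 1, b := Suc (cnt c b))")
  case True
  then show ?thesis using sum_power2_transfer_less[of "{1..k}" a b "cnt c"] a b ab by auto
next
  case False
  then obtain Q x p where Q: "Q \<in> J" "x \<in> Q" "x \<in> W" "c x = a" "b \<notin> c ` Q" "p \<in> X" "c p = b"
    using transfer_or_blocked[OF c a b ab] by blast
  have "\<exists>w\<in>Q. w \<noteq> x"
  proof (rule ccontr)
    assume "\<not> (\<exists>w\<in>Q. w \<noteq> x)"
    then have "Q \<subseteq> {x}" by blast
    then show False using W_large[OF Q(1-3)] card_mono[of "{x}" Q] by simp
  qed
  then obtain w where w: "w \<in> Q" "w \<noteq> x" by blast
  have wW: "w \<notin> W" using W_single Q w by blast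
  define d where "d = c w"
  have wJ: "w \<in> \<Union>J" using w Q by blast
  have d: "d \<in> {1..k}" "d \<noteq> a" "d \<noteq> b"
  proof -
    have "c ` \<Union>J \<subseteq> {1..k}" "inj_on c Q" using c Q by (auto simp: valid_def)
    then show "d \<in> {1..k}" "d \<noteq> a" "d \<noteq> b"
      using wJ w Q unfolding d_def by (blast, metis inj_onD, metis imageI)
  qed
  have noX: "d \<notin> c ` X" using X_single Q d by auto
  define c1 where "c1 = c(w := b)"
  have c1: "valid c1" unfolding c1_def using valid_upd[OF c Q(1) w(1) b Q(5)] wW by blast
  have cnt1: "cnt c1 = (cnt c)(d := cnt c d - 1, b := Suc (cnt c b))"
    unfolding c1_def d_def using cnt_upd[OF wJ] d by (simp add: d_def)
  \<comment> \<open>If neither the step from \<open>d\<close> to \<open>b\<close> nor the one from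
    \<open>a\<close> to \<open>d\<close> has a surplus of two, the counts of \<open>b\<close>,
    \<open>d\<close>, \<open>a\<close> must be consecutive.\<close>
  consider "cnt c b + 2 \<le> cnt c d" | "cnt c d + 2 \<le> cnt c a"
    | "cnt c d = cnt c b + 1" "cnt c a = cnt c b + 2"
    using ab by linarith
  then show ?thesis
  proof cases
    case 1
    then show ?thesis using sum_power2_transfer_less[of "{1..k}" d b "cnt c" "cnt c1"] b d c1 cnt1 by auto
  next
    case 2
    then obtain c' where "valid c'" "cnt c' = (cnt c)(a := cnt c a - 1, d := Suc (cnt c d))"
      using transfer_or_blocked[OF c a d(1)] noX by blast
    then show ?thesis using sum_power2_transfer_less[of "{1..k}" a d "cnt c"] a d 2 by auto
  next
    case 3
    have "w \<notin> X" using X_sub disjoint_A wJ by blast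
    then have noX1: "d \<notin> c1 ` X" using noX by (auto simp: c1_def)
    \<comment> \<open>Recolouring \<open>w\<close> has lowered the count of \<open>d\<close> by one,
      which creates the surplus of two over \<open>d\<close> needed for the second transfer.\<close>
    have 4: "cnt c1 d + 2 \<le> cnt c1 a" using 3 cnt1 d ab by auto
    then obtain c2 where c2: "valid c2" "cnt c2 = (cnt c1)(a := cnt c1 a - 1, d := Suc (cnt c1 d))"
      using transfer_or_blocked[OF c1 a d(1)] noX1 by blast
    \<comment> \<open>Both transfers together amount to the one from \<open>a\<close> to
      \<open>b\<close> that the case assumption excludes.\<close>
    have "cnt c2 = (cnt c)(a := cnt c a - 1, b := Suc (cnt c b))"
      using 3 d ab unfolding c2(2) cnt1 by (auto simp: fun_eq_iff)
    then show ?thesis using False c2(1) by blast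
  qed
qed

lemma ex_balanced_valid:
  "\<exists>c. valid c \<and> (\<forall>i\<in>{1..k}. \<forall>j\<in>{1..k}. cnt c i \<le> cnt c j + 1)"
proof -
  let ?m = "\<lambda>c. \<Sum>i\<in>{1..k}. (cnt c i)\<^sup>2"
  obtain c where c: "valid c" and min: "\<And>c'. valid c' \<Longrightarrow> ?m c \<le> ?m c'"
    using ex_valid ex_has_least_nat[of valid _ ?m] by blast
  have "cnt c i \<le> cnt c j + 1" if "i \<in> {1..k}" "j \<in> {1..k}" for i j
  proof (rule ccontr)
    assume "\<not> cnt c i \<le> cnt c j + 1"
    then have "cnt c j + 2 \<le> cnt c i" by simp
    from ex_smaller[OF c that this] obtain c' where "valid c'" "?m c' < ?m c" by blast
    then show False using min[of c'] by simp
  qed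
  then show ?thesis using c by blast
qed

end

subsection \<open>Leaf blocks of a clique partition\<close>

locale adjacency =
  fixes E :: "'a \<Rightarrow> 'a \<Rightarrow> bool"
  assumes adj_sym: "E x y \<Longrightarrow> E y x" and adj_irrefl: "\<not> E x x"
begin

text \<open>Connectivity relative to a vertex set, so that deleting vertices requires no new graph.
  By reflexivity vertices outside \<open>S\<close> are also related to themselves.\<close>

definition conn :: "'a set \<Rightarrow> ('a \<times> 'a) set" where
  "conn S = {(x, y). E x y \<and> x \<in> S \<and> y \<in> S}\<^sup>*"

text \<open>Maximality is not demanded, in contrast to \<open>is_clique\<close>.\<close>

definition clique :: "'a set \<Rightarrow> bool" where
  "clique C \<longleftrightarrow> (\<forall>x\<in>C. \<forall>y\<in>C. x \<noteq> y \<longrightarrow> E x y)"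

text \<open>
  The only property of block graphs that is used; unlike the definition by blocks, it obviously
  passes to induced subgraphs.
\<close>

definition block_on :: "'a set \<Rightarrow> bool" where
  "block_on V \<longleftrightarrow> (\<forall>u\<in>V. \<forall>x\<in>V. \<forall>y\<in>V. E u x \<longrightarrow> E u y \<longrightarrow> (x, y) \<in> conn (V - {u}) \<longrightarrow> x = y \<or> E x y)"

lemma block_onD:
  "block_on V \<Longrightarrow> u \<in> V \<Longrightarrow> x \<in> V \<Longrightarrow> y \<in> V \<Longrightarrow> E u x \<Longrightarrow> E u y \<Longrightarrow>
    (x, y) \<in> conn (V - {u}) \<Longrightarrow> x \<noteq> y \<Longrightarrow> E x y"
  unfolding block_on_def by (drule bspec, assumption)+ simp

lemma cliqueD: "clique C \<Longrightarrow> x \<in> C \<Longrightarrow> y \<in> C \<Longrightarrow> x \<noteq> y \<Longrightarrow> E x y"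
  unfolding clique_def by blast

lemma conn_refl [simp]: "(x, x) \<in> conn S"
  by (simp add: conn_def)

lemma conn_edge: "E x y \<Longrightarrow> x \<in> S \<Longrightarrow> y \<in> S \<Longrightarrow> (x, y) \<in> conn S"
  unfolding conn_def by blast

lemma conn_trans: "(x, y) \<in> conn S \<Longrightarrow> (y, z) \<in> conn S \<Longrightarrow> (x, z) \<in> conn S"
  unfolding conn_def by (rule rtrancl_trans)

lemma conn_sym: "(x, y) \<in> conn S \<Longrightarrow> (y, x) \<in> conn S"
proof -
  have "sym {(x, y). E x y \<and> x \<in> S \<and> y \<in> S}" using adj_sym by (auto simp: sym_def)
  then show "(x, y) \<in> conn S \<Longrightarrow> (y, x) \<in> conn S"
    unfolding conn_def by (rule symD[OF sym_rtrancl])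
qed

lemma conn_mono: "S \<subseteq> T \<Longrightarrow> (x, y) \<in> conn S \<Longrightarrow> (x, y) \<in> conn T"
  unfolding conn_def by (rule rtrancl_mono[THEN subsetD]) auto

lemma conn_mem: "(x, y) \<in> conn S \<Longrightarrow> x \<in> S \<Longrightarrow> y \<in> S"
  unfolding conn_def by (induction rule: rtrancl_induct) auto

text \<open>All vertices on a walk from \<open>x\<close> are reachable from \<open>x\<close>, so the
  walk cannot meet \<open>r\<close>.\<close>

lemma conn_avoid:
  assumes "(x, y) \<in> conn S" "(x, r) \<notin> conn S"
  shows "(x, y) \<in> conn (S - {r})"
  using assms(1) unfolding conn_def
proof (induction rule: rtrancl_induct)
  case (step y z)
  then have "(x, y) \<in> conn S" "(x, z) \<in> conn S" unfolding conn_def by (auto intro: rtrancl_into_rtrancl)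
  then have "y \<noteq> r" "z \<noteq> r" using assms(2) by auto
  then show ?case using step by (auto intro: rtrancl_into_rtrancl)
qed simp

lemma block_on_subset: "block_on V \<Longrightarrow> U \<subseteq> V \<Longrightarrow> block_on U"
  unfolding block_on_def
proof (intro ballI impI)
  fix u x y
  assume V: "\<forall>u\<in>V. \<forall>x\<in>V. \<forall>y\<in>V. E u x \<longrightarrow> E u y \<longrightarrow> (x, y) \<in> conn (V - {u}) \<longrightarrow> x = y \<or> E x y"
    and U: "U \<subseteq> V" and uxy: "u \<in> U" "x \<in> U" "y \<in> U" "E u x" "E u y" "(x, y) \<in> conn (U - {u})"
  have "(x, y) \<in> conn (V - {u})" by (rule conn_mono[OF _ uxy(6)]) (use U in blast)
  then show "x = y \<or> E x y" using V U uxy by blast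
qed

lemma clique_conn:
  assumes "clique C" "x \<in> C" "y \<in> C" "x \<in> S" "y \<in> S"
  shows "(x, y) \<in> conn S"
proof (cases "x = y")
  case False
  then show ?thesis using cliqueD[OF assms(1-3)] assms(4,5) by (intro conn_edge)
qed simp

text \<open>The descent step of both extremal arguments below. The component of \<open>y\<close> in
  \<open>V - {x}\<close> misses \<open>r\<close>, hence survives the removal of \<open>r\<close>,
  where the edge joins it to the additional vertex \<open>x\<close>.\<close>

lemma conn_Image_psubset:
  assumes "E x y" "x \<in> V" "y \<in> V" "x \<noteq> r" "(y, r) \<notin> conn (V - {x})"
  shows "conn (V - {x}) `` {y} \<subset> conn (V - {r}) `` {x}"
proof
  have yx: "y \<in> V - {x}" "y \<noteq> r" using assms adj_irrefl by auto
  show "conn (V - {x}) `` {y} \<subseteq> conn (V - {r}) `` {x}"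
  proof
    fix t assume "t \<in> conn (V - {x}) `` {y}"
    then have "(y, t) \<in> conn (V - {x} - {r})" using conn_avoid assms(5) by blast
    then have "(y, t) \<in> conn (V - {r})" by (rule conn_mono[rotated]) blast
    moreover have "(x, y) \<in> conn (V - {r})" using assms yx by (intro conn_edge) auto
    ultimately show "t \<in> conn (V - {r}) `` {x}" using conn_trans by blast
  qed
  have "(y, x) \<notin> conn (V - {x})" using conn_mem[of y x "V - {x}"] yx(1) by blast
  then have "x \<notin> conn (V - {x}) `` {y}" by simp
  moreover have "x \<in> conn (V - {r}) `` {x}" by simp
  ultimately show "conn (V - {x}) `` {y} \<noteq> conn (V - {r}) `` {x}" by metis
qed

lemma finite_conn_Image: "finite V \<Longrightarrow> x \<in> S \<Longrightarrow> S \<subseteq> V \<Longrightarrow> finite (conn S `` {x})"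
proof (rule finite_subset)
  assume "x \<in> S" "S \<subseteq> V"
  then show "conn S `` {x} \<subseteq> V" using conn_mem[of x _ S] by blast
qed

text \<open>A vertex next to a smallest component of some \<open>V - {r}\<close> cannot separate its neighbours.\<close>

lemma ex_simplicial:
  assumes V: "finite V" "V \<noteq> {}" "block_on V"
  shows "\<exists>v\<in>V. clique {x \<in> V. x = v \<or> E v x}"
proof (rule ccontr)
  assume no: "\<not> ?thesis"
  have nonadj: "\<exists>y\<in>V. \<exists>z\<in>V. E x y \<and> E x z \<and> y \<noteq> z \<and> \<not> E y z" if "x \<in> V" for x
    using no that adj_sym unfolding clique_def by blast
  obtain x0 where x0: "x0 \<in> V" using V by blast
  then obtain y0 where y0: "y0 \<in> V" "E x0 y0" using nonadj by blast
  define good where "good rx \<longleftrightarrow> fst rx \<in> V \<and> snd rx \<in> V \<and> snd rx \<noteq> fst rx" for rx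
  define m where "m rx = card (conn (V - {fst rx}) `` {snd rx})" for rx
  have "good (x0, y0)" using x0 y0 adj_irrefl by (auto simp: good_def)
  then obtain rx where rx: "good rx" and min: "\<And>rx'. good rx' \<Longrightarrow> m rx \<le> m rx'"
    using ex_has_least_nat[of good _ m] by blast
  obtain r x where "rx = (r, x)" by fastforce
  then have r: "r \<in> V" "x \<in> V" "x \<noteq> r" using rx by (auto simp: good_def)
  obtain y z where yz: "y \<in> V" "z \<in> V" "E x y" "E x z" "y \<noteq> z" "\<not> E y z"
    using nonadj r by blast
  \<comment> \<open>By the block property the nonadjacent neighbours \<open>y\<close> and
    \<open>z\<close> of \<open>x\<close> are separated in \<open>V - {x}\<close>, so they cannot
    both be connected to \<open>r\<close> there.\<close>
  have "(y, r) \<notin> conn (V - {x}) \<or> (z, r) \<notin> conn (V - {x})"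
    using block_onD[OF V(3) r(2) yz(1-4)] yz conn_sym conn_trans by blast
  then obtain w where w: "w \<in> V" "E x w" "(w, r) \<notin> conn (V - {x})" using yz by blast
  have "card (conn (V - {x}) `` {w}) < card (conn (V - {r}) `` {x})"
    using conn_Image_psubset[OF w(2) r(2) w(1) r(3) w(3)] finite_conn_Image[OF V(1), of x "V - {r}"] r
    by (intro psubset_card_mono) auto
  moreover have "good (x, w)" using r w adj_irrefl by (auto simp: good_def)
  ultimately show False using min[of "(x, w)"] \<open>rx = (r, x)\<close> by (simp add: m_def)
qed

text \<open>The set \<open>I\<close> will witness that the independence number is at least the
  number of parts. Each step adds the simplicial vertex to \<open>I\<close> and its closed
  neighbourhood to \<open>P\<close>.\<close>

lemma ex_clique_partition:
  assumes "finite V" "block_on V"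
  shows "\<exists>P I. partition_on V P \<and> (\<forall>Q\<in>P. clique Q) \<and> I \<subseteq> V \<and>
    (\<forall>x\<in>I. \<forall>y\<in>I. \<not> E x y) \<and> card I = card P"
  using assms
proof (induction V rule: finite_psubset_induct)
  case (psubset V)
  show ?case
  proof (cases "V = {}")
    case True
    then show ?thesis by (intro exI[of _ "{}"]) (auto simp: partition_on_def)
  next
    case False
    then obtain v where v: "v \<in> V" "clique {x \<in> V. x = v \<or> E v x}"
      using ex_simplicial[OF psubset.hyps False psubset.prems] by blast
    define N where "N = {x \<in> V. x = v \<or> E v x}"
    have N: "N \<subseteq> V" "v \<in> N" "clique N" using v by (auto simp: N_def)
    have "V - N \<subset> V" using N by blast
    from psubset.IH[OF this block_on_subset[OF psubset.prems]] obtain P I where PI: "partition_on (V - N) P" "\<forall>Q\<in>P. clique Q" "I \<subseteq> V - N"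
        "\<forall>x\<in>I. \<forall>y\<in>I. \<not> E x y" "card I = card P"
      by blast
    have P: "\<Union>P = V - N" using PI(1) by (simp add: partition_on_def)
    have "partition_on V (insert N P)"
      using PI(1) P N by (subst partition_on_insert) (auto simp: disjnt_def)
    moreover have "N \<notin> P" using P N by blast
    moreover have "v \<notin> I" using PI(3) N by blast
    moreover have "finite I" "finite P"
      using PI(1,3) psubset.hyps by (auto intro: finite_subset finite_elements)
    moreover have "\<not> E v x" "\<not> E x v" if "x \<in> I" for x
      using that PI(3) adj_sym by (auto simp: N_def)
    ultimately show ?thesis
      using PI N v adj_irrefl
      by (intro exI[of _ "insert N P"] exI[of _ "insert v I"]) auto
  qed
qed

text \<open>If \<open>d\<close> reached \<open>Q\<close> without \<open>p\<close>, it would reach,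
  along the clique, a vertex \<open>z\<close> of \<open>Q\<close> not adjacent to \<open>d\<close>.
  As \<open>d\<close> and \<open>z\<close> are both neighbours of \<open>p\<close>, the block
  property would make them adjacent.\<close>

lemma conn_disjoint_part:
  assumes B: "block_on V" and Q: "clique Q" "Q \<subseteq> V" and pd: "p \<in> Q" "d \<in> V" "d \<notin> Q" "E p d"
    and max: "\<exists>z\<in>Q. \<not> E d z" and t: "t \<in> Q"
  shows "(d, t) \<notin> conn (V - {p})"
proof
  assume dt: "(d, t) \<in> conn (V - {p})"
  have dp: "d \<in> V - {p}" using pd by auto
  obtain z where z: "z \<in> Q" "\<not> E d z" using max by blast
  then have zp: "z \<noteq> p" using pd adj_sym by blast
  have tp: "t \<noteq> p" using conn_mem[OF dt dp] by blast
  have "(t, z) \<in> conn (V - {p})" using Q(2) t tp z zp by (intro clique_conn[OF Q(1) t z(1)]) auto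
  then have "(d, z) \<in> conn (V - {p})" using dt conn_trans by blast
  moreover have "E p z" using cliqueD[OF Q(1) pd(1) z(1)] zp by blast
  ultimately have "d = z" using block_onD[OF B, of p d z] pd Q z by blast
  then show False using z pd by blast
qed

text \<open>
  Among all edges \<open>pd\<close> between different parts, take one for which the component of \<open>d\<close> in \<open>V - {p}\<close> is
  smallest. The neighbours of \<open>p\<close> in this component form \<open>W\<close>; any further edge leaving a part
  that meets \<open>W\<close> would cut off a smaller component.
\<close>

lemma ex_pendant_cliques:
  assumes V: "finite V" "V \<noteq> {}" "block_on V" and P: "partition_on V P"
    and cliques: "\<forall>Q\<in>P. clique Q" and maximal: "\<forall>Q\<in>P. \<forall>y\<in>V - Q. \<exists>z\<in>Q. \<not> E y z"
  obtains J X W where "J \<subseteq> P" "J \<noteq> {}" "X \<subseteq> V - \<Union>J" "\<forall>p\<in>X. \<forall>q\<in>X. p = q"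
    "W \<subseteq> \<Union>J" "clique (X \<union> W)" "\<forall>Q\<in>J. \<forall>x\<in>Q \<inter> W. 2 \<le> card Q \<and> (\<forall>y\<in>Q \<inter> W. x = y)"
    "\<forall>Q\<in>J. \<forall>x\<in>Q. \<forall>y\<in>V - Q. E x y \<longrightarrow> x \<in> W \<and> y \<in> X \<union> W"
proof -
  have part: "\<Union>P = V" using P by (simp add: partition_on_def)
  have uniq: "Q = R" if "Q \<in> P" "R \<in> P" "x \<in> Q" "x \<in> R" for Q R x
    using P that by (auto simp: partition_on_def disjoint_def)
  have cl: "clique Q" if "Q \<in> P" for Q using cliques that by blast
  have max: "\<exists>z\<in>Q. \<not> E y z" if "Q \<in> P" "y \<in> V - Q" for Q y using maximal that by blast
  show ?thesis
  proof (cases "\<exists>p\<in>V. \<exists>d\<in>V. E p d \<and> (\<forall>Q\<in>P. p \<in> Q \<longrightarrow> d \<notin> Q)")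
    case False
    \<comment> \<open>Without edges between different parts any single part can be split off, with
      \<open>X\<close> and \<open>W\<close> empty.\<close>
    have "P \<noteq> {}" using P V(2) by (auto simp: partition_on_def)
    then obtain Q where Q: "Q \<in> P" by blast
    have "Q \<subseteq> V" using P Q by (auto simp: partition_on_def)
    have "y \<in> Q" if "x \<in> Q" "y \<in> V" "E x y" for x y
      using False that \<open>Q \<subseteq> V\<close> uniq[OF Q _ that(1)] by blast
    then show ?thesis using that[of "{Q}" "{}" "{}"] Q by (force simp: clique_def)
  next
    case True
    define good where "good pd \<longleftrightarrow> fst pd \<in> V \<and> snd pd \<in> V \<and> E (fst pd) (snd pd) \<and>
      (\<forall>Q\<in>P. fst pd \<in> Q \<longrightarrow> snd pd \<notin> Q)" for pd
    define m where "m pd = card (conn (V - {fst pd}) `` {snd pd})" for pd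
    from True obtain pd0 where "good pd0" unfolding good_def by fastforce
    then obtain pd where pd: "good pd" and min: "\<And>pd'. good pd' \<Longrightarrow> m pd \<le> m pd'"
      using ex_has_least_nat[of good _ m] by blast
    obtain p d where pd_eq: "pd = (p, d)" by fastforce
    have p: "p \<in> V" "d \<in> V" "E p d" and cross: "\<And>Q. Q \<in> P \<Longrightarrow> p \<in> Q \<Longrightarrow> d \<notin> Q"
      using pd unfolding pd_eq good_def by auto
    define D where "D = conn (V - {p}) `` {d}"
    have dp: "d \<in> V - {p}" using p adj_irrefl by auto
    have DV: "D \<subseteq> V - {p}" using conn_mem dp unfolding D_def by blast
    have DD: "(x, y) \<in> conn (V - {p})" if "x \<in> D" "y \<in> D" for x y
      using that conn_sym conn_trans unfolding D_def by blast
    have Dclosed: "y \<in> D" if "x \<in> D" "E x y" "y \<in> V" "y \<noteq> p" for x y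
      using conn_trans[of d x "V - {p}" y] conn_edge[of x y "V - {p}"] that DV unfolding D_def by blast
    define W where "W = {x \<in> D. E p x}"
    define J where "J = {Q \<in> P. Q \<inter> W \<noteq> {}}"
    have noD: "Q \<inter> D = {}" if "Q \<in> P" "p \<in> Q" for Q
      using conn_disjoint_part[OF V(3) cl[OF that(1)] _ that(2) p(2) cross[OF that] p(3) max[OF that(1)]]
        part that cross p unfolding D_def by blast
    have pQ: "p \<notin> Q" if "Q \<in> J" for Q using noD that unfolding J_def W_def by blast
    have QV: "Q \<subseteq> V" if "Q \<in> J" for Q using that part unfolding J_def by blast
    have QD: "Q \<subseteq> D" if Q: "Q \<in> J" for Q
    proof
      fix y assume y: "y \<in> Q"
      obtain x where x: "x \<in> Q" "x \<in> D" using Q unfolding J_def W_def by blast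
      show "y \<in> D"
        using Dclosed[of x y] x y cliqueD[OF cl, of Q x y] Q pQ[OF Q] QV[OF Q] unfolding J_def by blast
    qed
    have Wcl: "clique ({p} \<union> W)"
      using block_onD[OF V(3) p(1)] DD DV adj_sym unfolding clique_def W_def by blast
    have WJ: "W \<subseteq> \<Union>J" using part DV by (auto simp: J_def W_def)
    have "d \<in> W" using p by (auto simp: W_def D_def)
    then have ne: "J \<noteq> {}" using WJ by blast
    \<comment> \<open>With two vertices \<open>x\<close> and \<open>y\<close> of \<open>Q\<close> in
      \<open>W\<close>, a vertex \<open>z\<close> of \<open>Q\<close> not adjacent to
      \<open>p\<close> would be connected to \<open>p\<close> through \<open>y\<close> off
      \<open>x\<close>. Both are neighbours of \<open>x\<close>, so they would be adjacent.\<close>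
    have single: "x = y" if Q: "Q \<in> J" and xy: "x \<in> Q" "y \<in> Q" "x \<in> W" "y \<in> W" for Q x y
    proof (rule ccontr)
      assume ne: "x \<noteq> y"
      have QP: "Q \<in> P" using Q by (simp add: J_def)
      obtain z where z: "z \<in> Q" "\<not> E p z" using max[OF QP, of p] p pQ[OF Q] by blast
      have E: "E p x" "E p y" using xy by (auto simp: W_def)
      then have zne: "z \<noteq> x" "z \<noteq> y" using z by auto
      have mem: "x \<in> V" "y \<in> V - {x}" "p \<in> V - {x}" "z \<in> V - {x}"
        using QV[OF Q] xy ne p(1) pQ[OF Q] z zne by auto
      have "(p, z) \<in> conn (V - {x})"
        using conn_trans[OF conn_edge[OF E(2) mem(3,2)] conn_edge[OF _ mem(2,4)]]
          cliqueD[OF cl[OF QP] xy(2) z(1)] zne by blast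
      then show False
        using block_onD[OF V(3) mem(1), of p z] mem E adj_sym cliqueD[OF cl[OF QP] xy(1) z(1)] zne z pQ[OF Q]
        by blast
    qed
    have large: "2 \<le> card Q" if Q: "Q \<in> J" and x: "x \<in> Q" "x \<in> W" for Q x
    proof -
      have QP: "Q \<in> P" using Q by (simp add: J_def)
      obtain z where z: "z \<in> Q" "\<not> E p z" using max[OF QP, of p] p pQ[OF Q] by blast
      then have "{x, z} \<subseteq> Q" "x \<noteq> z" using x by (auto simp: W_def)
      then show ?thesis using card_mono[of Q "{x, z}"] finite_subset[OF QV[OF Q] V(1)] by simp
    qed
    \<comment> \<open>For \<open>y \<noteq> p\<close>, minimality of \<open>D\<close> forces
      \<open>y\<close> to reach \<open>p\<close> off \<open>x\<close>. No vertex of \<open>Q\<close>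
      is reachable in this way, so \<open>p\<close> has no neighbour in \<open>Q\<close> besides
      \<open>x\<close>, and \<open>x\<close> is in \<open>W\<close>. Then \<open>p\<close> and
      \<open>y\<close> are neighbours of \<open>x\<close> connected off \<open>x\<close>, hence
      adjacent, and \<open>y\<close> is in \<open>W\<close>.\<close>
    have edges: "x \<in> W \<and> y \<in> {p} \<union> W"
      if Q: "Q \<in> J" and x: "x \<in> Q" and y: "y \<in> V" and E: "E x y" and yQ: "y \<notin> Q" for Q x y
    proof (cases "y = p")
      case True
      then show ?thesis using QD[OF Q] x E adj_sym by (auto simp: W_def)
    next
      case False
      have QP: "Q \<in> P" using Q by (simp add: J_def)
      have xD: "x \<in> D" "x \<in> V" "x \<noteq> p" using QD[OF Q] DV x by auto
      have yD: "y \<in> D" using Dclosed xD E y False by blast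
      have "good (x, y)" unfolding good_def using xD y E yQ uniq[OF QP] x by auto
      then have le: "card D \<le> card (conn (V - {x}) `` {y})"
        using min unfolding pd_eq m_def D_def by fastforce
      have sep: "(y, t) \<notin> conn (V - {x})" if "t \<in> Q" for t
        using conn_disjoint_part[OF V(3) cl[OF QP] QV[OF Q] x y yQ E max[OF QP] that] y yQ by blast
      have "conn (V - {p}) `` {x} = D"
        using DD xD conn_trans unfolding D_def by blast
      moreover have "finite D" using DV V(1) by (auto intro: finite_subset)
      ultimately have "\<not> conn (V - {x}) `` {y} \<subset> conn (V - {p}) `` {x}"
        using psubset_card_mono[of D "conn (V - {x}) `` {y}"] le by auto
      then have "(y, p) \<in> conn (V - {x})"
        using conn_Image_psubset[OF E xD(2) y xD(3)] by blast
      obtain v where v: "v \<in> Q" "v \<in> W" using Q by (auto simp: J_def)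
      have "x = v"
      proof (rule ccontr)
        assume "x \<noteq> v"
        then have "(p, v) \<in> conn (V - {x})"
          using v QV[OF Q] p(1) xD by (intro conn_edge) (auto simp: W_def)
        then show False using sep[OF v(1)] conn_trans[OF \<open>(y, p) \<in> conn (V - {x})\<close>] by blast
      qed
      then have "E x p" using v adj_sym by (auto simp: W_def)
      then have "E y p"
        using block_onD[OF V(3) xD(2) y p(1) E _ \<open>(y, p) \<in> conn (V - {x})\<close> False] by blast
      then show ?thesis using v yD adj_sym \<open>x = v\<close> by (auto simp: W_def)
    qed
    show ?thesis
    proof (rule that[of J "{p}" W])
      show "J \<subseteq> P" by (auto simp: J_def)
      show "{p} \<subseteq> V - \<Union>J" using pQ p by blast
    qed (use ne WJ Wcl single large edges in blast)+
  qed
qed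

text \<open>Well-coveredness enters only through a partition into maximal cliques, a property that
  the remaining parts inherit after a removal. Balance is stated by pairwise comparison, the form in
  which the extension step takes it.\<close>

lemma ex_balanced_coloring:
  fixes k :: nat
  assumes "finite V" "block_on V" "partition_on V P" "\<forall>Q\<in>P. clique Q"
    and "\<forall>Q\<in>P. \<forall>y\<in>V - Q. \<exists>z\<in>Q. \<not> E y z"
    and "\<forall>C\<subseteq>V. clique C \<longrightarrow> card C \<le> k"
  shows "\<exists>c. c ` V \<subseteq> {1..k} \<and> (\<forall>x\<in>V. \<forall>y\<in>V. E x y \<longrightarrow> c x \<noteq> c y) \<and>
    (\<forall>i\<in>{1..k}. \<forall>j\<in>{1..k}. card {v \<in> V. c v = i} \<le> card {v \<in> V. c v = j} + 1)"
  using assms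
proof (induction V arbitrary: P rule: finite_psubset_induct)
  case (psubset V)
  show ?case
  proof (cases "V = {}")
    case True
    then show ?thesis by simp
  next
    case False
    obtain J X W where J: "J \<subseteq> P" "J \<noteq> {}" and X: "X \<subseteq> V - \<Union>J" "\<forall>p\<in>X. \<forall>q\<in>X. p = q"
      and W: "W \<subseteq> \<Union>J" "clique (X \<union> W)"
        "\<forall>Q\<in>J. \<forall>x\<in>Q \<inter> W. 2 \<le> card Q \<and> (\<forall>y\<in>Q \<inter> W. x = y)"
      and edges: "\<forall>Q\<in>J. \<forall>x\<in>Q. \<forall>y\<in>V - Q. E x y \<longrightarrow> x \<in> W \<and> y \<in> X \<union> W"
      by (rule ex_pendant_cliques[OF psubset.hyps False psubset.prems(1-4)]) (rule that)
    have P: "\<Union>P = V" "disjoint P" "{} \<notin> P"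
      using psubset.prems(2) by (auto simp: partition_on_def)
    define A where "A = V - \<Union>J"
    have V: "V = A \<union> \<Union>J" using J P by (auto simp: A_def)
    obtain Q0 where "Q0 \<in> J" using J(2) by blast
    moreover have "Q0 \<noteq> {}" using calculation J(1) P(3) by blast
    ultimately have "\<Union>J \<noteq> {}" by blast
    then have AV: "A \<subset> V" using J(1) P(1) unfolding A_def by blast
    have "Q = R" if "Q \<in> P" "R \<in> P" "x \<in> Q" "x \<in> R" for Q R x
      using P(2) that by (auto simp: disjoint_def)
    then have "\<Union>(P - J) = A" unfolding A_def P(1)[symmetric] using J(1) by blast
    then have PA: "partition_on A (P - J)"
      using P by (auto simp: partition_on_def disjoint_def)
    have "block_on A" using AV block_on_subset[OF psubset.prems(1)] by blast
    moreover have "\<forall>Q\<in>P - J. clique Q" "\<forall>Q\<in>P - J. \<forall>y\<in>A - Q. \<exists>z\<in>Q. \<not> E y z"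
      "\<forall>C\<subseteq>A. clique C \<longrightarrow> card C \<le> k"
      using AV psubset.prems(3-5) by blast+
    ultimately have "\<exists>c. c ` A \<subseteq> {1..k} \<and> (\<forall>x\<in>A. \<forall>y\<in>A. E x y \<longrightarrow> c x \<noteq> c y) \<and>
      (\<forall>i\<in>{1..k}. \<forall>j\<in>{1..k}. card {v \<in> A. c v = i} \<le> card {v \<in> A. c v = j} + 1)"
      using psubset.IH[OF AV _ PA] by blast
    then obtain c0 where c0: "c0 ` A \<subseteq> {1..k}" "\<And>x y. x \<in> A \<Longrightarrow> y \<in> A \<Longrightarrow> E x y \<Longrightarrow> c0 x \<noteq> c0 y"
      "\<And>i j. i \<in> {1..k} \<Longrightarrow> j \<in> {1..k} \<Longrightarrow> card {v \<in> A. c0 v = i} \<le> card {v \<in> A. c0 v = j} + 1"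
      by blast
    interpret pendant_cliques A J X W k c0
    proof
      show "finite A" using AV psubset.hyps by (auto intro: finite_subset)
      show "finite J" using J(1) finite_elements[OF psubset.hyps psubset.prems(2)] by (rule finite_subset)
      show "finite Q" if "Q \<in> J" for Q using that J(1) P(1) psubset.hyps by (meson Union_upper finite_subset subsetD)
      show "disjoint J" using P(2) J(1) by (auto simp: disjoint_def)
      show "A \<inter> \<Union>J = {}" by (auto simp: A_def)
      show "X \<subseteq> A" using X by (simp add: A_def)
      show "card Q \<le> k" if "Q \<in> J" for Q using that J(1) P(1) psubset.prems(3,5) by (meson Union_upper subsetD)
      have "X \<union> W \<subseteq> V" using X(1) W(1) V by auto
      then show "card (X \<union> W) \<le> k" using psubset.prems(5) W(2) by simp
    qed (use X(2) W(1,3) c0 in blast)+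
    obtain c where c: "valid c" "\<forall>i\<in>{1..k}. \<forall>j\<in>{1..k}. cnt c i \<le> cnt c j + 1"
      using ex_balanced_valid by blast
    have one: "c x \<noteq> c y" if xy: "x \<in> \<Union>J" "y \<in> V" "E x y" for x y
    proof -
      obtain Q where Q: "Q \<in> J" "x \<in> Q" using xy by blast
      have "x \<noteq> y" using xy adj_irrefl by blast
      \<comment> \<open>Every edge that meets an added clique lies inside that clique or inside the
        attaching block, and \<open>c\<close> is injective on both.\<close>
      moreover have "(x \<in> Q \<and> y \<in> Q) \<or> (x \<in> X \<union> W \<and> y \<in> X \<union> W)" using edges Q xy(2,3) by auto
      ultimately show ?thesis using c(1) Q by (auto simp: valid_def dest: inj_onD)
    qed
    have "c x \<noteq> c y" if xy: "x \<in> V" "y \<in> V" "E x y" for x y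
    proof (cases "x \<in> A \<and> y \<in> A")
      case True
      then show ?thesis using c0(2) c(1) xy by (auto simp: valid_def)
    next
      case False
      then show ?thesis using one[of x y] one[of y x] xy V adj_sym by (metis UnE)
    qed
    moreover have "c ` V \<subseteq> {1..k}"
    proof -
      have "c ` A = c0 ` A" using c(1) by (intro image_cong) (auto simp: valid_def)
      moreover have "c ` \<Union>J \<subseteq> {1..k}" using c(1) by (simp add: valid_def)
      ultimately show ?thesis using c0(1) unfolding V image_Un by blast
    qed
    ultimately show ?thesis using c(2) unfolding cnt_def V[symmetric] by blast
  qed
qed

end

subsection \<open>Block graphs\<close>

context adjacency
begin

text \<open>A walk is shortened while it is built: if the new first vertex already occurs,
  everything before that occurrence is dropped.\<close>

lemma conn_imp_path:
  assumes "(x, y) \<in> conn S" "x \<in> S"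
  shows "\<exists>xs. xs \<noteq> [] \<and> hd xs = x \<and> last xs = y \<and> distinct xs \<and> set xs \<subseteq> S \<and> successively E xs"
  using assms unfolding conn_def
proof (induction rule: converse_rtrancl_induct)
  case base
  then show ?case by (intro exI[of _ "[y]"]) auto
next
  case (step x x')
  then obtain xs where xs: "xs \<noteq> []" "hd xs = x'" "last xs = y" "distinct xs" "set xs \<subseteq> S"
      "successively E xs" by auto
  show ?case
  proof (cases "x \<in> set xs")
    case True
    then obtain as bs where "xs = as @ x # bs" by (meson split_list)
    then show ?thesis using xs by (intro exI[of _ "x # bs"]) (auto simp: successively_append_iff)
  next
    case False
    then show ?thesis using xs step by (intro exI[of _ "x # xs"]) (auto simp: successively_Cons)
  qed
qed

lemma path_conn_hd: "successively E xs \<Longrightarrow> b \<in> set xs \<Longrightarrow> (hd xs, b) \<in> conn (set xs)"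
proof (induction xs)
  case (Cons a xs)
  show ?case
  proof (cases "b = a")
    case False
    then have b: "b \<in> set xs" using Cons.prems by simp
    then have "(hd xs, b) \<in> conn (set xs)" using Cons by (auto simp: successively_Cons)
    then have "(hd xs, b) \<in> conn (set (a # xs))" by (rule conn_mono[rotated]) auto
    moreover have "xs \<noteq> []" using b by auto
    then have "E a (hd xs)" "hd xs \<in> set xs" using Cons.prems by (auto simp: successively_Cons)
    then have "(a, hd xs) \<in> conn (set (a # xs))" by (intro conn_edge) auto
    ultimately show ?thesis using conn_trans by auto
  qed simp
qed simp

lemma path_conn: "successively E xs \<Longrightarrow> a \<in> set xs \<Longrightarrow> b \<in> set xs \<Longrightarrow> (a, b) \<in> conn (set xs)"
proof -
  assume "successively E xs" "a \<in> set xs" "b \<in> set xs"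
  then have "(hd xs, a) \<in> conn (set xs)" "(hd xs, b) \<in> conn (set xs)"
    by (auto intro: path_conn_hd)
  then show "(a, b) \<in> conn (set xs)" using conn_sym conn_trans by blast
qed

text \<open>The path \<open>xs\<close> closes to a cycle through \<open>u\<close>. Deleting
  \<open>v\<close> from the path leaves an initial segment joined to \<open>u\<close> by its head
  and a final segment joined to \<open>u\<close> by its last vertex.\<close>

lemma cycle_conn:
  assumes xs: "successively E xs" "xs \<noteq> []" "distinct xs" and u: "u \<notin> set xs" "E u (hd xs)" "E u (last xs)"
    and ab: "a \<in> insert u (set xs) - {v}" "b \<in> insert u (set xs) - {v}"
  shows "(a, b) \<in> conn (insert u (set xs) - {v})"
proof (cases "v = u")
  case True
  then have "insert u (set xs) - {v} = set xs" using u by auto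
  then show ?thesis using path_conn[OF xs(1)] ab by auto
next
  case v: False
  let ?S = "insert u (set xs) - {v}"
  have toward: "(u, c) \<in> conn ?S" if c: "c \<in> ?S" for c
  proof (cases "c = u")
    case False
    then have c': "c \<in> set xs" "c \<noteq> v" using c by auto
    have sub: "(u, c) \<in> conn ?S" if ys: "successively E ys" "set ys \<subseteq> set xs - {v}" "c \<in> set ys"
        "d \<in> set ys" "E u d" for ys d
    proof -
      have "(d, c) \<in> conn ?S" using ys(2) by (intro conn_mono[OF _ path_conn[OF ys(1,4,3)]]) auto
      moreover have "(u, d) \<in> conn ?S" using ys(2,4,5) v by (intro conn_edge) auto
      ultimately show ?thesis using conn_trans by blast
    qed
    show ?thesis
    proof (cases "v \<in> set xs")
      case False
      then show ?thesis using sub[OF xs(1) _ c'(1) _ u(2)] xs(2) by auto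
    next
      case True
      then obtain as bs where xsd: "xs = as @ v # bs" by (meson split_list)
      have suc: "successively E as" "successively E bs"
        using xs(1) by (auto simp: xsd successively_append_iff successively_Cons)
      from c' xsd consider "c \<in> set as" | "c \<in> set bs" by auto
      then show ?thesis
      proof cases
        case 1
        then have "as \<noteq> []" by auto
        then have "hd as \<in> set as" "E u (hd as)" using u by (auto simp: xsd)
        then show ?thesis using sub[OF suc(1) _ 1] xs(3) by (auto simp: xsd)
      next
        case 2
        then have "bs \<noteq> []" by auto
        then have "last bs \<in> set bs" "E u (last bs)" using u by (auto simp: xsd)
        then show ?thesis using sub[OF suc(2) _ 2] xs(3) by (auto simp: xsd)
      qed
    qed
  qed simp
  show ?thesis using toward[OF ab(1)] toward[OF ab(2)] conn_sym conn_trans by blast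
qed

end

text \<open>Maximising the number of vertices plus arcs suffices: a larger subgraph with the same
  count has the same vertices and arcs, and compatibility fixes \<open>tail\<close> and
  \<open>head\<close>.\<close>

lemma (in fin_digraph) ex_max_subgraph:
  assumes "subgraph H G" "P H"
  obtains B where "max_subgraph P B" "subgraph H B"
proof -
  define good where "good B \<longleftrightarrow> subgraph H B \<and> subgraph B G \<and> P B" for B
  define m where "m B = card (verts B) + card (arcs B)" for B :: "('a, 'b) pre_digraph"
  have bound: "\<forall>B. good B \<longrightarrow> m B < card (verts G) + card (arcs G) + 1"
    unfolding good_def m_def
    by (auto simp: subgraph_def less_Suc_eq_le intro!: add_mono card_mono)
  have "wf_digraph H" using assms(1) by (simp add: subgraph_def)
  then have "good H" using assms wf_digraph.subgraph_refl by (auto simp: good_def)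
  then obtain B where B: "good B" and max: "\<And>B'. good B' \<Longrightarrow> m B' \<le> m B"
    using ex_has_greatest_nat[OF _ bound] by blast
  have "H' = B" if H': "subgraph B H'" "subgraph H' G" "P H'" for H'
  proof -
    have "subgraph H H'" using B H'(1) subgraph_trans unfolding good_def by blast
    then have le: "m H' \<le> m B" using max H' by (simp add: good_def)
    have sub: "verts B \<subseteq> verts H'" "arcs B \<subseteq> arcs H'" using H'(1) by (auto simp: subgraph_def)
    have fin: "finite (verts H')" "finite (arcs H')"
      using H'(2) by (auto simp: subgraph_def intro: finite_subset)
    have "card (verts B) \<le> card (verts H')" "card (arcs B) \<le> card (arcs H')"
      using sub fin by (auto intro: card_mono)
    then have "card (verts B) = card (verts H')" "card (arcs B) = card (arcs H')"
      using le by (auto simp: m_def)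
    then have "verts B = verts H'" "arcs B = arcs H'"
      using card_subset_eq[OF fin(1) sub(1)] card_subset_eq[OF fin(2) sub(2)] by auto
    moreover have "tail B = tail H'" "head B = head H'" using H'(1) by (auto simp: subgraph_def compatible_def)
    ultimately show "H' = B" by (auto intro: pre_digraph.equality)
  qed
  then have "max_subgraph P B" using B by (auto simp: max_subgraph_def good_def)
  then show ?thesis using that B by (auto simp: good_def)
qed

section \<open>From blocks and cliques of a graph to its adjacency relation\<close>

context graph
begin

sublocale adj: adjacency "\<lambda>u v. u \<rightarrow>\<^bsub>G\<^esub> v"
proof
  show "y \<rightarrow>\<^bsub>G\<^esub> x" if "x \<rightarrow>\<^bsub>G\<^esub> y" for x y using graph_symmetric that by blast
  show "\<not> x \<rightarrow>\<^bsub>G\<^esub> x" for x using adj_not_same by blast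
qed

lemma graph_induce: "S \<subseteq> verts G \<Longrightarrow> graph (G \<restriction> S)"
proof -
  assume S: "S \<subseteq> verts G"
  interpret d: digraph "G \<restriction> S" using induced_induce[OF S] by (rule digraphI_induced)
  interpret s: sym_digraph "G \<restriction> S" using induced_induce[OF S] by (rule induced_graph_imp_graph)
  show ?thesis by unfold_locales
qed

lemma adj_induce_iff: "u \<rightarrow>\<^bsub>G \<restriction> S\<^esub> v \<longleftrightarrow> u \<rightarrow>\<^bsub>G\<^esub> v \<and> u \<in> S \<and> v \<in> S"
  by (auto simp: arcs_ends_conv)

lemma connected_induce:
  assumes S: "S \<subseteq> verts G" "S \<noteq> {}" and conn: "\<And>x y. x \<in> S \<Longrightarrow> y \<in> S \<Longrightarrow> (x, y) \<in> adj.conn S"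
  shows "connected (G \<restriction> S)"
proof -
  interpret S: graph "G \<restriction> S" using S(1) by (rule graph_induce)
  have "{(x, y). x \<rightarrow>\<^bsub>G\<^esub> y \<and> x \<in> S \<and> y \<in> S} = arcs_ends (G \<restriction> S)"
    using adj_induce_iff by auto
  then have "x \<rightarrow>\<^sup>*\<^bsub>G \<restriction> S\<^esub> y" if "x \<in> S" "y \<in> S" for x y
    using conn[OF that] that unfolding adj.conn_def S.reachable_conv by simp
  \<comment> \<open>\<open>connected\<close> refers to the symmetric closure, which does not change
    reachability in a symmetric digraph.\<close>
  then have "x \<rightarrow>\<^sup>*\<^bsub>mk_symmetric (G \<restriction> S)\<^esub> y" if "x \<in> S" "y \<in> S" for x y
    using that by (simp add: S.reachable_mk_symmetric_eq[OF S.sym_arcs])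
  then show ?thesis using S by (intro S.connectedI) auto
qed

lemma del_vert_induce: "pre_digraph.del_vert (G \<restriction> S) v = G \<restriction> (S - {v})"
  by (auto simp: pre_digraph.del_vert_def induce_subgraph_def)

text \<open>A path from \<open>x\<close> to \<open>y\<close> off \<open>u\<close> closes to a cycle
  through \<open>u\<close>. Chords in the subgraph induced by its vertices do no harm.\<close>

lemma two_connected_cycle:
  assumes u: "u \<in> verts G" "u \<rightarrow>\<^bsub>G\<^esub> x" "u \<rightarrow>\<^bsub>G\<^esub> y" and "x \<noteq> y" and xy: "(x, y) \<in> adj.conn (verts G - {u})"
  obtains S where "S \<subseteq> verts G" "x \<in> S" "y \<in> S" "two_connected (G \<restriction> S)"
proof -
  have "x \<in> verts G - {u}" using u(2) adj_in_verts adj_not_same by blast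
  then obtain xs where xs: "xs \<noteq> []" "hd xs = x" "last xs = y" "distinct xs" "set xs \<subseteq> verts G - {u}"
      "successively (\<lambda>u v. u \<rightarrow>\<^bsub>G\<^esub> v) xs"
    using adj.conn_imp_path[OF xy] by blast
  define S where "S = insert u (set xs)"
  have S: "S \<subseteq> verts G" "x \<in> S" "y \<in> S" using xs u by (auto simp: S_def)
  have u': "u \<notin> set xs" using xs(5) by blast
  have conn: "(a, b) \<in> adj.conn (S - {v})" if "a \<in> S - {v}" "b \<in> S - {v}" for a b v
    using adj.cycle_conn[OF xs(6,1,4) u'] u xs that by (auto simp: S_def)
  have xyu: "{x, y, u} \<subseteq> S" "x \<noteq> u" "y \<noteq> u" using S u' xs by (auto simp: S_def)
  have ne: "S - {v} \<noteq> {}" for v using xyu \<open>x \<noteq> y\<close> by blast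
  \<comment> \<open>Each \<open>c\<close> is connected to \<open>x\<close> even after deleting a
    third vertex of the cycle: \<open>y\<close>, or \<open>u\<close> when \<open>c\<close> is
    \<open>y\<close>.\<close>
  have connS: "(a, b) \<in> adj.conn S" if "a \<in> S" "b \<in> S" for a b
  proof -
    have "(c, x) \<in> adj.conn S" if "c \<in> S" for c
    proof (cases "c = y")
      case False
      then have "(c, x) \<in> adj.conn (S - {y})" using that S \<open>x \<noteq> y\<close> by (intro conn) auto
      then show ?thesis by (rule adj.conn_mono[rotated]) blast
    next
      case True
      then have "(c, x) \<in> adj.conn (S - {u})" using S xyu by (intro conn) auto
      then show ?thesis by (rule adj.conn_mono[rotated]) blast
    qed
    then show ?thesis using that adj.conn_sym adj.conn_trans by blast
  qed
  have "finite S" using S(1) finite_verts by (rule finite_subset)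
  then have "3 \<le> card S" using card_mono[OF _ xyu(1)] xyu(2,3) \<open>x \<noteq> y\<close> by simp
  moreover have "connected (G \<restriction> (S - {v}))" for v using S ne conn by (intro connected_induce) auto
  moreover have "connected (G \<restriction> S)" using S connS by (intro connected_induce) auto
  ultimately have "two_connected (G \<restriction> S)"
    using graph_induce[OF S(1)] by (simp add: two_connected_def del_vert_induce)
  then show ?thesis using that S by blast
qed

text \<open>Two neighbours of \<open>u\<close> connected off \<open>u\<close> lie on a common cycle,
  hence in a maximal two-connected subgraph. This is a block and therefore complete.\<close>

lemma block_on_verts:
  assumes "block_graph G"
  shows "adj.block_on (verts G)"
  unfolding adj.block_on_def
proof (intro ballI impI)
  fix u x y
  assume u: "u \<in> verts G" "u \<rightarrow>\<^bsub>G\<^esub> x" "u \<rightarrow>\<^bsub>G\<^esub> y" and xy: "(x, y) \<in> adj.conn (verts G - {u})"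
  show "x = y \<or> x \<rightarrow>\<^bsub>G\<^esub> y"
  proof (cases "x = y")
    case False
    then obtain S where S: "S \<subseteq> verts G" "x \<in> S" "y \<in> S" "two_connected (G \<restriction> S)"
      using two_connected_cycle u xy by blast
    obtain B where B: "max_subgraph two_connected B" "subgraph (G \<restriction> S) B"
      using ex_max_subgraph[of "G \<restriction> S" two_connected] subgraph_induce_subgraphI S by blast
    then have "is_clique G B" using assms by (auto simp: block_graph_def is_block_def)
    then have B': "complete_graph B" "subgraph B G" by (auto simp: is_clique_def max_subgraph_def)
    have "x \<in> verts B" "y \<in> verts B" using B(2) S by (auto simp: subgraph_def)
    then have "x \<rightarrow>\<^bsub>B\<^esub> y" using B'(1) False by (simp add: complete_graph_def complete_digraph_def)
    then show ?thesis using adj_mono B'(2) by blast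
  qed simp
qed

text \<open>\<open>clique_number\<close> ranges over maximal complete subgraphs only, so
  \<open>C\<close> is first extended to one.\<close>

lemma card_clique_le_clique_number:
  assumes "C \<subseteq> verts G" "adj.clique C"
  shows "card C \<le> clique_number G"
proof -
  have "arcs_ends (G \<restriction> C) = {(u, v). (u, v) \<in> C \<times> C \<and> u \<noteq> v}"
    using assms adj_induce_iff adj_not_same by (auto simp: adj.clique_def)
  then have "complete_graph (G \<restriction> C)"
    using graph_induce[OF assms(1)] by (simp add: complete_graph_def complete_digraph_def)
  then obtain B where B: "max_subgraph complete_graph B" "subgraph (G \<restriction> C) B"
    using ex_max_subgraph[of "G \<restriction> C" complete_graph] subgraph_induce_subgraphI[OF assms(1)] by blast
  have bound: "verts D \<subseteq> verts G" if "is_clique G D" for D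
    using that by (auto simp: is_clique_def max_subgraph_def subgraph_def)
  have "finite {card (verts D) | D. is_clique G D}"
    by (rule finite_subset[of _ "{..card (verts G)}"]) (auto intro: card_mono[OF finite_verts bound])
  moreover have "is_clique G B" using B by (simp add: is_clique_def)
  ultimately have "card (verts B) \<le> clique_number G" unfolding clique_number_def by (intro Max_ge) auto
  moreover have "C \<subseteq> verts B" "finite (verts B)"
    using B(2) finite_subset[OF bound[OF \<open>is_clique G B\<close>] finite_verts] by (auto simp: subgraph_def)
  ultimately show ?thesis using card_mono order_trans by blast
qed

lemma card_independent_set_le_alpha:
  assumes "independent_set G S"
  shows "card S \<le> alpha G"
proof -
  have "finite {card S | S. independent_set G S}"
    by (rule finite_subset[of _ "card ` Pow (verts G)"]) (auto simp: independent_set_def)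
  then show ?thesis unfolding alpha_def using assms by (intro Max_ge) auto
qed

text \<open>
  A maximum independent set containing \<open>y\<close> has as many elements as there are parts, so it
  meets every part.
\<close>

lemma part_maximal_clique:
  assumes wc: "well_covered G" and P: "partition_on (verts G) P" and cl: "\<forall>Q\<in>P. adj.clique Q"
    and I: "independent_set G I" "card I = card P" and Q: "Q \<in> P" and y: "y \<in> verts G - Q"
  shows "\<exists>z\<in>Q. \<not> y \<rightarrow>\<^bsub>G\<^esub> z"
proof -
  have part: "\<Union>P = verts G" "finite P"
    using P finite_elements[OF _ P] by (auto simp: partition_on_def)
  obtain S where S: "independent_set G S" "card S = alpha G" "y \<in> S"
    using wc y well_covered_iff[OF graph_axioms] by blast
  have "\<forall>s\<in>S. \<exists>R\<in>P. s \<in> R" using S(1) part(1) by (auto simp: independent_set_def)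
  then obtain f where f: "\<And>s. s \<in> S \<Longrightarrow> f s \<in> P" "\<And>s. s \<in> S \<Longrightarrow> s \<in> f s" by metis
  have inj: "inj_on f S"
  proof (rule inj_onI, rule ccontr)
    fix s t assume st: "s \<in> S" "t \<in> S" "f s = f t" "s \<noteq> t"
    have "adj.clique (f s)" "s \<in> f s" "t \<in> f s" using st f cl by metis+
    then have "s \<rightarrow>\<^bsub>G\<^esub> t" using st(4) by (rule adj.cliqueD)
    then show False using S(1) st by (auto simp: independent_set_def)
  qed
  have "card P \<le> card S" using card_independent_set_le_alpha[OF I(1)] I(2) S(2) by simp
  moreover have "f ` S \<subseteq> P" using f by blast
  ultimately have "f ` S = P" using card_image[OF inj] part(2) by (intro card_seteq) auto
  then obtain z where z: "z \<in> S" "z \<in> Q" using Q f by blast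
  then show ?thesis using S(1,3) by (auto simp: independent_set_def)
qed

end

section \<open>From balanced classes to rounded averages\<close>

lemma floor_ceiling_cases:
  fixes r :: real and t :: int
  assumes "t - 1 < r" "r < t + 1"
  shows "t \<in> {\<lfloor>r\<rfloor>, \<lceil>r\<rceil>}"
proof (cases "t \<le> r")
  case True
  then have "\<lfloor>r\<rfloor> = t" using assms by (intro floor_unique) auto
  then show ?thesis by simp
next
  case False
  then have "\<lceil>r\<rceil> = t" using assms by (intro ceiling_unique) auto
  then show ?thesis by simp
qed

text \<open>Every class differs from class \<open>i\<close> by at most one, and class
  \<open>i\<close> does not differ from itself. Summing over all colours therefore puts the average
  strictly within one of \<open>?n i\<close>.\<close>

lemma balanced_card:
  fixes c :: "'a \<Rightarrow> nat" and k :: nat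
  assumes V: "finite V" "c ` V \<subseteq> {1..k}" and i: "i \<in> {1..k}"
    and bal: "\<forall>i\<in>{1..k}. \<forall>j\<in>{1..k}. card {v \<in> V. c v = i} \<le> card {v \<in> V. c v = j} + 1"
  shows "int (card {v \<in> V. c v = i}) \<in>
    {\<lfloor>real (card V) / real k\<rfloor>, \<lceil>real (card V) / real k\<rceil>}"
proof -
  let ?n = "\<lambda>i. card {v \<in> V. c v = i}"
  have k: "0 < k" using i by auto
  have "card V = (\<Sum>v\<in>V. 1)" by simp
  also have "\<dots> = (\<Sum>j\<in>{1..k}. \<Sum>v\<in>{v \<in> V. c v = j}. 1)"
    using V by (intro sum.group[symmetric]) auto
  finally have n: "card V = (\<Sum>j\<in>{1..k}. ?n j)" by simp
  have "(\<Sum>j\<in>{1..k}. ?n j) < (\<Sum>j\<in>{1..k}. ?n i + 1)"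
    using bal i by (intro sum_strict_mono_ex1) auto
  then have lt: "card V < k * (?n i + 1)" unfolding n by simp
  have "(\<Sum>j\<in>{1..k}. ?n i) < (\<Sum>j\<in>{1..k}. ?n j + 1)"
    using bal i by (intro sum_strict_mono_ex1) auto
  moreover have "(\<Sum>j\<in>{1..k}. ?n j + 1) = (\<Sum>j\<in>{1..k}. ?n j) + k" by (subst sum.distrib) simp
  ultimately have gt: "k * ?n i < card V + k" unfolding n by simp
  have "real (card V) / real k < real (?n i) + 1"
    using lt k by (simp add: field_simps flip: of_nat_add of_nat_mult of_nat_Suc)
  moreover have "real (?n i) - 1 < real (card V) / real k"
    using gt k by (simp add: field_simps flip: of_nat_add of_nat_mult of_nat_Suc)
  ultimately show ?thesis by (intro floor_ceiling_cases) auto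
qed

theorem theorem3:
  fixes G :: "('a,'b) pre_digraph" and k :: nat
  assumes "graph G" and "block_graph G" and "well_covered G"
    and "k \<ge> clique_number G"
  shows "\<exists>c. equitable_coloring G k c"
proof -
  interpret graph G by fact
  have B: "adj.block_on (verts G)" using assms(2) by (rule block_on_verts)
  obtain P I where P: "partition_on (verts G) P" "\<forall>Q\<in>P. adj.clique Q" and
    I: "I \<subseteq> verts G" "\<forall>x\<in>I. \<forall>y\<in>I. \<not> x \<rightarrow>\<^bsub>G\<^esub> y" "card I = card P"
    using adj.ex_clique_partition[OF finite_verts B] by blast
  have "independent_set G I" using I by (simp add: independent_set_def)
  then have "\<forall>Q\<in>P. \<forall>y\<in>verts G - Q. \<exists>z\<in>Q. \<not> y \<rightarrow>\<^bsub>G\<^esub> z"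
    using part_maximal_clique[OF assms(3) P _ I(3)] by blast
  moreover have "\<forall>C\<subseteq>verts G. adj.clique C \<longrightarrow> card C \<le> k"
    using card_clique_le_clique_number assms(4) order_trans by blast
  ultimately obtain c where c: "c ` verts G \<subseteq> {1..k}"
      "\<forall>x\<in>verts G. \<forall>y\<in>verts G. x \<rightarrow>\<^bsub>G\<^esub> y \<longrightarrow> c x \<noteq> c y"
      "\<forall>i\<in>{1..k}. \<forall>j\<in>{1..k}. card {v \<in> verts G. c v = i} \<le> card {v \<in> verts G. c v = j} + 1"
    using adj.ex_balanced_coloring[OF finite_verts B P, of k] by blast
  have "proper_coloring G k c"
    using c(1,2) adj_in_verts unfolding proper_coloring_def by blast
  then have "equitable_coloring G k c"
    using balanced_card[OF finite_verts c(1) _ c(3)] unfolding equitable_coloring_def by blast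
  then show ?thesis by blast
qed

end
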